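(* Let $a>0$ and $k\in\mathbb{R}$. Then for all $n,m\in\mathbb{N}_0$, $$\frac{1}{2\pi}\int_{-2\sqrt a}^{2\sqrt a}\frac{\sqrt{4a-t^2}\,D_{n,k}(t)D_{m,k}(t)}{(k-1)t^2+a(k-2)^2}\,dt+\chi(k)\,\frac{(2-k)k}{k-1}\left[\frac{1+(-1)^{n+m}}{2}\right]\left(\mathrm{i}\sqrt{\frac{a}{k-1}}\right)^{n+m}=h_n(k)\,\delta_{n,m},$$ where $h_0(k)=2-k$, $h_n(k)=a^n$ for $n\ge1$, and $\chi(k)=0$ if $k\in[0,2]$, $\chi(k)=1$ if $k\in\mathbb{R}\setminus[0,2]$. For $k=1$ the second summand on the left is understood to be $0$.
   Context: $\mathbb{N}_0=\{0,1,2,\dots\}$, $\delta_{n,m}$ is Kronecker's delta, $\mathrm{i}^2=-1$, and $\sqrt{\cdot}$ is the principal branch of the square root. For $a>0$, $k\in\mathbb{R}$, the Dickson polynomials of the $(k+1)$-th kind $D_{n,k}(x)=D_{n,k}(x;a)$ are defined by $D_{0,k}(x;a)=2-k$ and, for $n\ge1$, $$D_{n,k}(x;a)=\sum_{j=0}^{\lfloor n/2\rfloor}\frac{n-kj}{n-j}\binom{n-j}{j}(-a)^jx^{n-2j};$$ equivalently $D_{0,k}=2-k$, $D_{1,k}=x$, $D_{n+2,k}=xD_{n+1,k}-aD_{n,k}$. When $k=2$, the denominator in the integral is $t^2$ and every $D_{n,2}(t)$ is divisible by $t$, so the integrand is read as $\sqrt{4a-t^2}\,(D_{n,2}(t)/t)(D_{m,2}(t)/t)$.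 *)

theory Defs
  imports "HOL-Analysis.Analysis" "HOL-Computational_Algebra.Polynomial"
begin

text \<open>Dickson polynomials of the \<open>(k+1)\<close>-th kind with parameter \<open>a\<close>.\<close>

definition dickson :: "real \<Rightarrow> real \<Rightarrow> nat \<Rightarrow> real poly" where
  "dickson a k n =
     (if n = 0 then [:2 - k:]
      else \<Sum>j\<le>n div 2.
             monom ((real n - k * real j) / real (n - j) * real ((n - j) choose j) * (- a) ^ j)
                   (n - 2 * j))"

lemma X_dvd_dickson_2: "[:0, 1:] dvd dickson a 2 n"
proof -
  have "coeff (dickson a 2 n) 0 = 0"
    by (auto simp: dickson_def coeff_sum intro!: sum.neutral)
  then show ?thesis
    by (simp add: dvd_iff_poly_eq_0 poly_0_coeff_0)
qed

text \<open>
  For \<open>k = 2\<close> the denominator is \<open>t\<^sup>2\<close>, which is cancelled against the factor \<open>t\<close> of each of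
  the two polynomials (see \<open>X_dvd_dickson_2\<close>). For \<open>k = 0\<close> the denominator vanishes at
  both endpoints \<open>\<plusminus>2\<surd>a\<close>, where the division yields \<open>0\<close>; for all other \<open>k\<close> it is positive on
  the interval of integration.
\<close>

definition dickson_integrand :: "real \<Rightarrow> real \<Rightarrow> nat \<Rightarrow> nat \<Rightarrow> real \<Rightarrow> real" where
  "dickson_integrand a k n m t =
     (if k = 2
      then sqrt (4 * a - t\<^sup>2) * poly (dickson a 2 n div [:0, 1:]) t
                             * poly (dickson a 2 m div [:0, 1:]) t
      else sqrt (4 * a - t\<^sup>2) * poly (dickson a k n) t * poly (dickson a k m) t
             / ((k - 1) * t\<^sup>2 + a * (k - 2)\<^sup>2))"

definition dickson_chi :: "real \<Rightarrow> real" where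
  "dickson_chi k = (if k \<in> {0..2} then 0 else 1)"

definition dickson_h :: "real \<Rightarrow> real \<Rightarrow> nat \<Rightarrow> real" where
  "dickson_h a k n = (if n = 0 then 2 - k else a ^ n)"

text \<open>\<open>csqrt\<close> is the principal branch; its argument is negative for \<open>k < 1\<close>.\<close>

definition dickson_discrete_term :: "real \<Rightarrow> real \<Rightarrow> nat \<Rightarrow> nat \<Rightarrow> complex" where
  "dickson_discrete_term a k n m =
     (if k = 1 then 0
      else of_real (dickson_chi k) * of_real ((2 - k) * k / (k - 1))
             * of_real ((1 + (- 1) ^ (n + m)) / 2)
             * (\<i> * csqrt (of_real (a / (k - 1)))) ^ (n + m))"

end

theory Submission imports Defs begin

text \<open>
  Put \<open>c = k - 1\<close>, \<open>s = \<surd>a\<close> and \<open>t = 2 s cos \<theta>\<close>. Then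
  \<open>sin \<theta> D\<^sub>n(t) = s\<^sup>n Im (z\<^sup>n\<^sup>+\<^sup>1 + c z\<^sup>n\<^sup>-\<^sup>1)\<close> with \<open>z = cis \<theta>\<close>, and the denominator of the integrand becomes
  \<open>a \<bar>1 + c z\<^sup>2\<bar>\<^sup>2\<close>. Hence the integral reduces to the Fourier coefficients of the unimodular
  function \<open>(z\<^sup>2 + c) / (1 + c z\<^sup>2)\<close>. Multiplying by \<open>1 + c z\<^sup>2\<close> gives a two-term recurrence for
  these coefficients; as they are bounded, those of positive index vanish if \<open>\<bar>c\<bar> < 1\<close>, and those of
  negative index vanish if \<open>\<bar>c\<bar> > 1\<close>. In the latter case the recurrence then produces the discrete term.
\<close>


section \<open>Dickson polynomials in trigonometric form\<close>

text \<open>The Dickson polynomial of the second kind (\<open>k = 1\<close>), as a function. Beyond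
  \<open>n div 2\<close> the binomials are zero, so the range up to \<open>n\<close> gives the same
  value and keeps index shifts simple.\<close>

definition dickson2 :: "real \<Rightarrow> nat \<Rightarrow> real \<Rightarrow> real" where
  "dickson2 a n x = (\<Sum>j\<le>n. real ((n - j) choose j) * (- a) ^ j * x ^ (n - 2 * j))"

text \<open>Pascal's rule, applied termwise after the shift j = \<open>Suc i\<close>; the leading
  power comes from \<open>x * dickson2 a (n + 1) x\<close> alone.\<close>

lemma dickson2_rec: "dickson2 a (n + 2) x = x * dickson2 a (n + 1) x - a * dickson2 a n x"
proof -
  have pascal: "real ((n + 2 - Suc i) choose Suc i) * (- a) ^ Suc i * x ^ (n + 2 - 2 * Suc i)
        = x * (real ((n + 1 - Suc i) choose Suc i) * (- a) ^ Suc i * x ^ (n + 1 - 2 * Suc i))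
          - a * (real ((n - i) choose i) * (- a) ^ i * x ^ (n - 2 * i))" if "i \<le> n" for i
  proof -
    have "n + 2 - Suc i = Suc (n - i)" using that by simp
    \<comment> \<open>Truncated subtraction in the exponent matters only if
      \<open>Suc i > n - i\<close>, and then the binomial is zero.\<close>
    moreover have "x * (real ((n - i) choose Suc i) * x ^ (n + 1 - 2 * Suc i))
        = real ((n - i) choose Suc i) * x ^ (n - 2 * i)"
    proof (cases "Suc i \<le> n - i")
      case True
      then have "n - 2 * i = Suc (n + 1 - 2 * Suc i)" by simp
      then show ?thesis by simp
    qed simp
    ultimately show ?thesis by (auto simp: algebra_simps)
  qed
  have "dickson2 a (n + 2) x = x ^ (n + 2)
      + (\<Sum>i\<le>n. real ((n + 2 - Suc i) choose Suc i) * (- a) ^ Suc i * x ^ (n + 2 - 2 * Suc i))"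
    unfolding dickson2_def
    by (simp only: add_2_eq_Suc' sum.atMost_Suc_shift[of _ "Suc n"] sum.atMost_Suc[of _ n]) simp
  also have "\<dots> = x * (x ^ (n + 1) + (\<Sum>i\<le>n. real ((n + 1 - Suc i) choose Suc i) * (- a) ^ Suc i
        * x ^ (n + 1 - 2 * Suc i))) - a * dickson2 a n x"
  proof -
    have "(\<Sum>i\<le>n. real ((n + 2 - Suc i) choose Suc i) * (- a) ^ Suc i * x ^ (n + 2 - 2 * Suc i))
        = x * (\<Sum>i\<le>n. real ((n + 1 - Suc i) choose Suc i) * (- a) ^ Suc i * x ^ (n + 1 - 2 * Suc i))
          - a * dickson2 a n x"
      unfolding dickson2_def sum_distrib_left sum_subtractf[symmetric]
      by (rule sum.cong[OF refl]) (simp only: pascal atMost_iff)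
    then show ?thesis by (simp add: distrib_left)
  qed
  also have "x ^ (n + 1) + (\<Sum>i\<le>n. real ((n + 1 - Suc i) choose Suc i) * (- a) ^ Suc i
        * x ^ (n + 1 - 2 * Suc i)) = dickson2 a (n + 1) x"
    unfolding dickson2_def by (simp add: sum.atMost_Suc_shift del: sum.atMost_Suc)
  finally show ?thesis .
qed

lemma dickson2_half:
  "dickson2 a n x = (\<Sum>j\<le>n div 2. real ((n - j) choose j) * (- a) ^ j * x ^ (n - 2 * j))"
  unfolding dickson2_def by (rule sum.mono_neutral_right) (auto simp: binomial_eq_0)

text \<open>With N = n + 2, write N - kj = (N - j) - (k - 1)j. The absorption identity turns j/(N -
  j) times the binomial (N - j over j) into (N - j - 1 over j - 1), so after the shift j =
  \<open>Suc i\<close> the second part is a second-kind polynomial of degree n.\<close>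

lemma poly_dickson_Suc_Suc:
  "poly (dickson a k (n + 2)) x = dickson2 a (n + 2) x + (k - 1) * a * dickson2 a n x"
proof -
  have coeff: "(real (n + 2) - k * real (Suc i)) / real (n + 2 - Suc i)
        * real ((n + 2 - Suc i) choose Suc i)
      = real ((n + 2 - Suc i) choose Suc i) - (k - 1) * real ((n - i) choose i)"
    if "i \<le> n div 2" for i
  proof -
    have le: "i \<le> n" using that by simp
    then have eq: "n + 2 - Suc i = Suc (n - i)" by simp
    have "real (Suc i) * real (Suc (n - i) choose Suc i) = real (Suc (n - i)) * real ((n - i) choose i)"
      using Suc_times_binomial_eq[of "n - i" i] by (metis mult.commute of_nat_mult)
    then have binom: "real ((n - i) choose i) = real (Suc i) * real (Suc (n - i) choose Suc i) / real (Suc (n - i))"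
      by (metis nonzero_mult_div_cancel_left of_nat_neq_0)
    have sum: "real (n + 2) = real (Suc (n - i)) + real (Suc i)"
      using le by simp
    have "(M + J - k * J) / M * B = B - (k - 1) * (J * B / M)" if "M \<noteq> 0" for M J B :: real
      using that by (simp add: field_simps)
    then show ?thesis
      unfolding eq binom sum by (metis of_nat_neq_0)
  qed
  have "poly (dickson a k (n + 2)) x = x ^ (n + 2)
      + (\<Sum>i\<le>n div 2. (real (n + 2) - k * real (Suc i)) / real (n + 2 - Suc i)
          * real ((n + 2 - Suc i) choose Suc i) * (- a) ^ Suc i * x ^ (n + 2 - 2 * Suc i))"
    unfolding dickson_def
    by (simp add: poly_sum poly_monom sum.atMost_Suc_shift del: sum.atMost_Suc binomial_Suc_Suc)
      (simp add: add_diff_eq)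
  also have "\<dots> = x ^ (n + 2)
      + (\<Sum>i\<le>n div 2. real ((n + 2 - Suc i) choose Suc i) * (- a) ^ Suc i * x ^ (n + 2 - 2 * Suc i)
          + (k - 1) * a * (real ((n - i) choose i) * (- a) ^ i * x ^ (n - 2 * i)))"
    by (intro arg_cong2[of _ _ _ _ "(+)"] sum.cong refl, subst coeff) (simp_all add: algebra_simps)
  also have "\<dots> = dickson2 a (n + 2) x + (k - 1) * a * dickson2 a n x"
    unfolding dickson2_half sum.distrib sum_distrib_left
    by (simp add: sum.atMost_Suc_shift del: sum.atMost_Suc binomial_Suc_Suc)
  finally show ?thesis .
qed

text \<open>These are rescaled Chebyshev polynomials of the second kind: both sides satisfy the same
  three-term recurrence. Keeping the factor \<open>sin \<theta>\<close> avoids a division.\<close>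

lemma sin_times_dickson2:
  "sin \<theta> * dickson2 (s\<^sup>2) n (2 * s * cos \<theta>) = s ^ n * sin (real (n + 1) * \<theta>)"
proof (induction n rule: induct_nat_012)
  case 1
  show ?case by (simp add: dickson2_def sin_double)
next
  case (ge2 n)
  have "real (n + 3) * \<theta> = real (n + 2) * \<theta> + \<theta>" "real (n + 1) * \<theta> = real (n + 2) * \<theta> - \<theta>"
    by (simp_all add: algebra_simps)
  then have trig: "sin (real (n + 3) * \<theta>) = 2 * cos \<theta> * sin (real (n + 2) * \<theta>) - sin (real (n + 1) * \<theta>)"
    by (simp only: sin_add sin_diff) simp
  have "sin \<theta> * dickson2 (s\<^sup>2) (n + 2) (2 * s * cos \<theta>)
      = 2 * s * cos \<theta> * (sin \<theta> * dickson2 (s\<^sup>2) (n + 1) (2 * s * cos \<theta>))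
        - s\<^sup>2 * (sin \<theta> * dickson2 (s\<^sup>2) n (2 * s * cos \<theta>))"
    unfolding dickson2_rec by (simp add: algebra_simps)
  also have "\<dots> = 2 * s * cos \<theta> * (s ^ (n + 1) * sin (real (n + 2) * \<theta>))
        - s\<^sup>2 * (s ^ n * sin (real (n + 1) * \<theta>))"
    using ge2 by simp
  also have "\<dots> = s ^ (n + 2) * sin (real (n + 3) * \<theta>)"
    unfolding trig by (simp add: algebra_simps power2_eq_square)
  finally show ?case by (simp add: numeral_3_eq_3)
qed (simp add: dickson2_def)

text \<open>From degree 2 on, this combines two second-kind formulas. The subtraction
  \<open>real n - 1\<close> is real: for \<open>n = 0\<close> it gives frequency -1, which accounts
  for the exceptional constant \<open>2 - k\<close>.\<close>

lemma sin_times_dickson: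
  "sin \<theta> * poly (dickson (s\<^sup>2) k n) (2 * s * cos \<theta>)
     = s ^ n * (sin ((real n + 1) * \<theta>) + (k - 1) * sin ((real n - 1) * \<theta>))"
proof (induction n rule: induct_nat_012)
  case 0
  show ?case by (simp add: dickson_def algebra_simps)
next
  case 1
  show ?case by (simp add: dickson_def poly_monom sin_double)
next
  case (ge2 n)
  have "sin \<theta> * poly (dickson (s\<^sup>2) k (n + 2)) (2 * s * cos \<theta>)
      = s ^ (n + 2) * sin (real (n + 3) * \<theta>) + (k - 1) * s\<^sup>2 * (s ^ n * sin (real (n + 1) * \<theta>))"
  proof -
    have "sin \<theta> * (p + (k - 1) * s\<^sup>2 * q) = sin \<theta> * p + (k - 1) * s\<^sup>2 * (sin \<theta> * q)" for p q
      by (simp add: algebra_simps)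
    then show ?thesis
      unfolding poly_dickson_Suc_Suc
      by (simp only: sin_times_dickson2) (simp add: add.commute)
  qed
  then show ?case by (simp add: algebra_simps power2_eq_square)
qed

section \<open>The unimodular phase function\<close>

text \<open>For \<open>\<bar>c\<bar> = 1\<close> the quotient equals \<open>c\<close> away from its removable singularities.\<close>

definition phase :: "real \<Rightarrow> real \<Rightarrow> complex" where
  "phase c \<theta> = (if \<bar>c\<bar> = 1 then of_real c
     else (cis (2 * \<theta>) + of_real c) / (1 + of_real c * cis (2 * \<theta>)))"

lemma phase_denom_nonzero: "1 + complex_of_real c * cis x \<noteq> 0" if "\<bar>c\<bar> \<noteq> 1"
proof
  assume "1 + complex_of_real c * cis x = 0"
  then have "complex_of_real c * cis x = - 1" by (simp add: add_eq_0_iff)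
  then have "norm (complex_of_real c * cis x) = norm (- 1 :: complex)" by presburger
  with that show False by (simp add: norm_mult)
qed

text \<open>As \<open>c\<close> is real, the numerator is \<open>cis (2 * \<theta>)\<close> times
  the conjugate of the denominator. This later bounds all Fourier coefficients uniformly.\<close>

lemma norm_phase: "norm (phase c \<theta>) = 1"
proof (cases "\<bar>c\<bar> = 1")
  case False
  have "cis (2 * \<theta>) + of_real c = cis (2 * \<theta>) * cnj (1 + of_real c * cis (2 * \<theta>))"
    by (simp add: cis_cnj distrib_left mult.left_commute cis_mult)
  then have "norm (cis (2 * \<theta>) + of_real c) = norm (1 + of_real c * cis (2 * \<theta>))"
    by (simp only: norm_mult norm_cis complex_mod_cnj mult_1)
  with False phase_denom_nonzero[OF False, of "2 * \<theta>"] show ?thesis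
    by (simp add: phase_def norm_divide)
qed (simp add: phase_def)

lemma continuous_on_phase [continuous_intros]: "continuous_on A (phase c)"
proof (cases "\<bar>c\<bar> = 1")
  case False
  then have "phase c = (\<lambda>\<theta>. (cis (2 * \<theta>) + of_real c) / (1 + of_real c * cis (2 * \<theta>)))"
    by (simp add: phase_def fun_eq_iff)
  with phase_denom_nonzero[OF False] show ?thesis
    by (auto intro!: continuous_intros)
qed (simp add: phase_def[abs_def])

text \<open>The real factor is the squared modulus of
  \<open>1 + of_real c * cis (2 * \<theta>)\<close>, so one conjugate factor cancels. For
  \<open>\<bar>c\<bar> = 1\<close> the constant phase satisfies the same identity, even where the
  factor is zero.\<close>

lemma denom_times_phase:
  "of_real (1 + c\<^sup>2 + 2 * c * cos (2 * \<theta>)) * phase c \<theta>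
     = cis (2 * \<theta>) + 2 * of_real c + of_real (c\<^sup>2) * cis (- (2 * \<theta>))"
proof (cases "\<bar>c\<bar> = 1")
  case True
  then have "c = 1 \<or> c = -1" by auto
  then show ?thesis by (auto simp: phase_def complex_eq_iff)
next
  case False
  let ?q = "1 + of_real c * cis (2 * \<theta>)"
  have q: "of_real (1 + c\<^sup>2 + 2 * c * cos (2 * \<theta>)) = ?q * cnj ?q"
    by (simp add: complex_eq_iff cis_cnj algebra_simps power2_eq_square)
  have "of_real (1 + c\<^sup>2 + 2 * c * cos (2 * \<theta>)) * phase c \<theta> = (cis (2 * \<theta>) + of_real c) * cnj ?q"
    unfolding q using False phase_denom_nonzero[OF False, of "2 * \<theta>"] by (simp add: phase_def)
  also have "\<dots> = cis (2 * \<theta>) + 2 * of_real c + of_real (c\<^sup>2) * cis (- (2 * \<theta>))"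
    by (simp add: cis_cnj algebra_simps cis_mult power2_eq_square)
  finally show ?thesis .
qed

text \<open>Expanding by product-to-sum formulas, the cosines around frequency \<open>x - y\<close>
  collect to a multiple of \<open>q\<close>, and those around \<open>x + y\<close> to the real part
  of a multiple of \<open>q * phase c \<theta>\<close>; then \<open>q\<close> cancels.\<close>

lemma sin_sum_product:
  fixes c \<theta> x y :: real
  defines "q \<equiv> 1 + c\<^sup>2 + 2 * c * cos (2 * \<theta>)"
  assumes "q \<noteq> 0"
  shows "(sin ((x + 1) * \<theta>) + c * sin ((x - 1) * \<theta>)) * (sin ((y + 1) * \<theta>) + c * sin ((y - 1) * \<theta>)) / q
     = (cos ((x - y) * \<theta>) - Re (cis ((x + y) * \<theta>) * phase c \<theta>)) / 2"
proof -
  have "2 * ((sin ((x + 1) * \<theta>) + c * sin ((x - 1) * \<theta>)) * (sin ((y + 1) * \<theta>) + c * sin ((y - 1) * \<theta>)))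
      = cos ((x - y) * \<theta>) * q
        - (cos ((x + y) * \<theta> + 2 * \<theta>) + 2 * c * cos ((x + y) * \<theta>) + c\<^sup>2 * cos ((x + y) * \<theta> - 2 * \<theta>))"
  proof -
    have "sin ((x + 1) * \<theta>) * sin ((y + 1) * \<theta>) = (cos ((x - y) * \<theta>) - cos ((x + y) * \<theta> + 2 * \<theta>)) / 2"
      "sin ((x + 1) * \<theta>) * sin ((y - 1) * \<theta>) = (cos ((x - y) * \<theta> + 2 * \<theta>) - cos ((x + y) * \<theta>)) / 2"
      "sin ((x - 1) * \<theta>) * sin ((y + 1) * \<theta>) = (cos ((x - y) * \<theta> - 2 * \<theta>) - cos ((x + y) * \<theta>)) / 2"
      "sin ((x - 1) * \<theta>) * sin ((y - 1) * \<theta>) = (cos ((x - y) * \<theta>) - cos ((x + y) * \<theta> - 2 * \<theta>)) / 2"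
      unfolding sin_times_sin
      by (intro arg_cong2[of _ _ _ _ "\<lambda>u v. (cos u - cos v) / 2"]; simp add: algebra_simps)+
    moreover have "cos ((x - y) * \<theta>) * cos (2 * \<theta>) = (cos ((x - y) * \<theta> - 2 * \<theta>) + cos ((x - y) * \<theta> + 2 * \<theta>)) / 2"
      by (rule cos_times_cos)
    moreover have "2 * ((p + c * p') * (r + c * r')) = 2 * (p * r) + 2 * c * (p * r') + 2 * c * (p' * r) + 2 * c\<^sup>2 * (p' * r')"
      for p p' r r' by (simp add: algebra_simps power2_eq_square)
    moreover have "p * q = p + c\<^sup>2 * p + 2 * c * (p * cos (2 * \<theta>))" for p
      by (simp add: q_def algebra_simps)
    ultimately show ?thesis
      by (simp only:) (simp add: field_simps)
  qed
  \<comment> \<open>The weights 1, 2c, c^2 at the shifts 2\<theta>, 0, -2\<theta> are those of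
    \<open>denom_times_phase\<close>.\<close>
  also have "cos ((x + y) * \<theta> + 2 * \<theta>) + 2 * c * cos ((x + y) * \<theta>) + c\<^sup>2 * cos ((x + y) * \<theta> - 2 * \<theta>)
      = Re (cis ((x + y) * \<theta>) * (of_real q * phase c \<theta>))"
    unfolding q_def denom_times_phase by (simp add: distrib_left mult.left_commute cis_mult) (simp add: cos_diff distrib_left)
  also have "\<dots> = q * Re (cis ((x + y) * \<theta>) * phase c \<theta>)"
    by (simp add: mult.left_commute algebra_simps)
  finally show ?thesis using \<open>q \<noteq> 0\<close> by (simp add: field_simps)
qed


section \<open>Fourier coefficients of the phase\<close>

lemma has_integral_cis:
  "((\<lambda>\<theta>. cis (of_int j * \<theta>)) has_integral (if j = 0 then of_real (2 * pi) else 0)) {- pi..pi}"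
proof (cases "j = 0")
  case True
  then show ?thesis
    using has_integral_const_real[of "1 :: complex" "- pi" pi] by (simp add: scaleR_conv_of_real)
next
  case False
  have "((\<lambda>\<theta>. cis (of_int j * \<theta>)) has_integral
      cis (of_int j * pi) / (\<i> * of_int j) - cis (of_int j * (- pi)) / (\<i> * of_int j)) {- pi..pi}"
  proof (rule fundamental_theorem_of_calculus)
    fix \<theta> assume "\<theta> \<in> {- pi..pi}"
    show "((\<lambda>\<theta>. cis (of_int j * \<theta>) / (\<i> * of_int j)) has_vector_derivative cis (of_int j * \<theta>))
      (at \<theta> within {- pi..pi})"
      unfolding has_vector_derivative_def using False
      by (auto intro!: derivative_eq_intros simp: scaleR_conv_of_real field_simps fun_eq_iff)
  qed simp
  moreover have "cis (of_int j * pi) = cis (of_int j * (- pi))"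
    by (auto simp: complex_eq_iff sin_zero_iff_int2)
  ultimately show ?thesis using False by simp
qed

text \<open>In the usual convention this is 2 pi times the Fourier coefficient of index
  \<open>- j\<close>.\<close>

definition phase_coeff :: "real \<Rightarrow> int \<Rightarrow> complex" where
  "phase_coeff c j = integral {- pi..pi} (\<lambda>\<theta>. cis (of_int j * \<theta>) * phase c \<theta>)"

lemma has_integral_phase_coeff:
  "((\<lambda>\<theta>. cis (of_int j * \<theta>) * phase c \<theta>) has_integral phase_coeff c j) {- pi..pi}"
  unfolding phase_coeff_def
  by (intro integrable_integral integrable_continuous_real continuous_intros)

lemma norm_phase_coeff_le: "norm (phase_coeff c j) \<le> 2 * pi"
proof -
  have "norm (phase_coeff c j) \<le> 1 * (pi - (- pi))"
    unfolding phase_coeff_def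
    by (intro integral_bound continuous_intros) (simp_all add: norm_mult norm_phase)
  then show ?thesis by simp
qed

text \<open>Multiplication by \<open>1 + of_real c * cis (2 * \<theta>)\<close> leaves a combination
  of two exponentials, so by orthogonality the recurrence is homogeneous except at
  \<open>j = - 2\<close> and \<open>j = 0\<close>.\<close>

lemma phase_coeff_rec:
  assumes "\<bar>c\<bar> \<noteq> 1"
  shows "phase_coeff c j + of_real c * phase_coeff c (j + 2)
    = (if j = - 2 then of_real (2 * pi) else 0) + of_real c * (if j = 0 then of_real (2 * pi) else 0)"
proof (rule has_integral_unique)
  show "((\<lambda>\<theta>. cis (of_int j * \<theta>) * phase c \<theta> + of_real c * (cis (of_int (j + 2) * \<theta>) * phase c \<theta>))
      has_integral phase_coeff c j + of_real c * phase_coeff c (j + 2)) {- pi..pi}"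
    by (intro has_integral_add has_integral_mult_right has_integral_phase_coeff)
  have "((\<lambda>\<theta>. cis (of_int (j + 2) * \<theta>) + of_real c * cis (of_int j * \<theta>))
      has_integral (if j + 2 = 0 then of_real (2 * pi) else 0)
        + of_real c * (if j = 0 then of_real (2 * pi) else 0)) {- pi..pi}"
    by (intro has_integral_add has_integral_mult_right has_integral_cis)
  moreover have "cis (of_int j * \<theta>) * phase c \<theta> + of_real c * (cis (of_int (j + 2) * \<theta>) * phase c \<theta>)
      = cis (of_int (j + 2) * \<theta>) + of_real c * cis (of_int j * \<theta>)" for \<theta>
  proof -
    have "cis (of_int (j + 2) * \<theta>) = cis (of_int j * \<theta>) * cis (2 * \<theta>)"
      by (simp add: cis_mult distrib_right)
    moreover have "(1 + of_real c * cis (2 * \<theta>)) * phase c \<theta> = cis (2 * \<theta>) + of_real c"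
      using assms phase_denom_nonzero[OF assms, of "2 * \<theta>"] by (simp add: phase_def)
    moreover have "w * p + of_real c * (w * z * p) = w * ((1 + of_real c * z) * p)" for w z p :: complex
      by (simp add: algebra_simps)
    ultimately show ?thesis by (simp only:) (simp add: algebra_simps)
  qed
  moreover have "j + 2 = 0 \<longleftrightarrow> j = - 2" by auto
  ultimately show "((\<lambda>\<theta>. cis (of_int j * \<theta>) * phase c \<theta> + of_real c * (cis (of_int (j + 2) * \<theta>) * phase c \<theta>))
      has_integral (if j = - 2 then of_real (2 * pi) else 0)
        + of_real c * (if j = 0 then of_real (2 * pi) else 0)) {- pi..pi}"
    by simp
qed

text \<open>Iteration gives \<open>u 0 = r ^ i * u i\<close>, a bounded sequence times powers
  tending to zero.\<close>

lemma bounded_contracting_recurrence_zero: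
  fixes u :: "nat \<Rightarrow> 'a :: real_normed_field"
  assumes rec: "\<And>i. u i = r * u (Suc i)" and "norm r < 1" and bound: "\<And>i. norm (u i) \<le> B"
  shows "u 0 = 0"
proof -
  have "u 0 = r ^ i * u i" for i
  proof (induction i)
    case (Suc i)
    then show ?case using rec[of i] by (simp add: mult_ac)
  qed simp
  then have "norm (u 0) \<le> norm r ^ i * B" for i
    by (metis bound mult_left_mono norm_ge_zero norm_mult norm_power zero_le_power)
  moreover have "(\<lambda>i. norm r ^ i * B) \<longlonglongrightarrow> 0 * B"
    using \<open>norm r < 1\<close> by (intro tendsto_intros LIMSEQ_power_zero) simp
  ultimately have "norm (u 0) \<le> 0 * B"
    by (intro LIMSEQ_le_const[of "\<lambda>i. norm r ^ i * B"]) auto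
  then show ?thesis by simp
qed

text \<open>For \<open>\<bar>c\<bar> = 1\<close> the phase is constant. Otherwise the recurrence,
  followed towards larger indices, contracts by \<open>- c\<close> and kills all positive ones; its
  instance at 0 then leaves only the source term there.\<close>

lemma phase_coeff_inside:
  assumes "\<bar>c\<bar> \<le> 1"
  shows "phase_coeff c (int N) = (if N = 0 then of_real (2 * pi * c) else 0)"
proof (cases "\<bar>c\<bar> = 1")
  case True
  have "((\<lambda>\<theta>. cis (of_int (int N) * \<theta>) * phase c \<theta>)
      has_integral (if int N = 0 then of_real (2 * pi) else 0) * of_real c) {- pi..pi}"
    unfolding phase_def if_P[OF True] by (intro has_integral_mult_left has_integral_cis)
  then show ?thesis
    using has_integral_unique[OF has_integral_phase_coeff] by (auto split: if_splits)
next
  case False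
  have pos: "phase_coeff c j = 0" if "j > 0" for j
  proof -
    have "phase_coeff c (j + 2 * int 0) = 0"
    proof (rule bounded_contracting_recurrence_zero[where r = "- of_real c"])
      fix i show "phase_coeff c (j + 2 * int i) = - of_real c * phase_coeff c (j + 2 * int (Suc i))"
        using phase_coeff_rec[OF False, of "j + 2 * int i"] that
        by (simp add: algebra_simps add_eq_0_iff2)
    qed (use assms False norm_phase_coeff_le in auto)
    then show ?thesis by simp
  qed
  show ?thesis
    using phase_coeff_rec[OF False, of 0] pos[of 2] pos[of "int N"] by auto
qed

text \<open>Now the recurrence contracts by \<open>- 1 / c\<close> towards smaller indices, so the
  negative ones vanish. Going back up, the odd chain meets no source term, while the even chain
  picks up those at \<open>- 2\<close> and \<open>0\<close> and is geometric from index 2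
  on.\<close>

lemma phase_coeff_outside:
  assumes "\<bar>c\<bar> > 1"
  shows phase_coeff_outside_0: "phase_coeff c 0 = of_real (2 * pi / c)"
    and phase_coeff_outside_odd: "phase_coeff c (int (2 * p + 1)) = 0"
    and phase_coeff_outside_even:
      "p > 0 \<Longrightarrow> phase_coeff c (int (2 * p)) = of_real (- 2 * pi * (c - 1 / c) * (- 1 / c) ^ p)"
proof -
  have c: "\<bar>c\<bar> \<noteq> 1" "c \<noteq> 0" using assms by auto
  have neg: "phase_coeff c j = 0" if "j < 0" for j
  proof -
    have "phase_coeff c (j - 2 * int 0) = 0"
    proof (rule bounded_contracting_recurrence_zero[where r = "- of_real (1 / c)"])
      fix i
      \<comment> \<open>As \<open>j < 0\<close>, the lower index lies below \<open>- 2\<close>, away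
        from both source terms.\<close>
      have "phase_coeff c (j - 2 * int (Suc i)) + of_real c * phase_coeff c (j - 2 * int i) = 0"
        using phase_coeff_rec[OF c(1), of "j - 2 * int (Suc i)"] that
        by (simp add: algebra_simps)
      then show "phase_coeff c (j - 2 * int i) = - of_real (1 / c) * phase_coeff c (j - 2 * int (Suc i))"
        using c(2) by (simp add: field_simps add_eq_0_iff2)
    qed (use assms norm_phase_coeff_le in \<open>auto simp: norm_divide\<close>)
    then show ?thesis by simp
  qed
  show zero: "phase_coeff c 0 = of_real (2 * pi / c)"
    using phase_coeff_rec[OF c(1), of "- 2"] neg[of "- 2"] c(2) by (simp add: field_simps)
  have step: "phase_coeff c (j + 2) = of_real (- 1 / c) * phase_coeff c j" if "j > 0" for j
    using phase_coeff_rec[OF c(1), of j] that c(2) by (simp add: field_simps add_eq_0_iff2)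
  show "phase_coeff c (int (2 * p + 1)) = 0"
  proof (induction p)
    case 0
    show ?case using phase_coeff_rec[OF c(1), of "- 1"] neg[of "- 1"] c(2) by simp
  next
    case (Suc p)
    then show ?case using step[of "int (2 * p + 1)"] by (simp add: algebra_simps)
  qed
  show "phase_coeff c (int (2 * p)) = of_real (- 2 * pi * (c - 1 / c) * (- 1 / c) ^ p)" if "p > 0"
    using that
  proof (induction p rule: nat_induct_non_zero)
    case 1
    \<comment> \<open>The source term at index 0 enters here, so the geometric law starts at
      \<open>p = 1\<close> and does not extend to \<open>p = 0\<close>.\<close>
    have "of_real c * phase_coeff c 2 = of_real (2 * pi * c) - phase_coeff c 0"
      using phase_coeff_rec[OF c(1), of 0] by (simp add: algebra_simps)
    then have "phase_coeff c 2 = of_real ((2 * pi * c - 2 * pi / c) / c)"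
      unfolding zero using c(2) by (simp add: field_simps)
    also have "(2 * pi * c - 2 * pi / c) / c = - 2 * pi * (c - 1 / c) * (- 1 / c) ^ 1"
      using c(2) by (simp add: field_simps)
    finally show ?case by simp
  next
    case (Suc p)
    have "int (2 * Suc p) = int (2 * p) + 2" by simp
    then have "phase_coeff c (int (2 * Suc p)) = of_real (- 1 / c) * phase_coeff c (int (2 * p))"
      using step[of "int (2 * p)"] Suc.hyps by (simp only:)
    also have "\<dots> = of_real (- 2 * pi * (c - 1 / c) * (- 1 / c) ^ Suc p)"
      unfolding Suc.IH of_real_mult[symmetric] by (simp only: power_Suc mult.left_commute)
    finally show ?case .
  qed
qed

section \<open>Substitution in the integral\<close>

lemma phase_minus: "phase c (- \<theta>) = cnj (phase c \<theta>)"
  by (simp add: phase_def cis_cnj)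

text \<open>The right-hand side of \<open>sin_sum_product\<close> is taken instead of the quotient
  because it is continuous everywhere, also where the denominator is zero.\<close>

definition sine_product :: "real \<Rightarrow> nat \<Rightarrow> nat \<Rightarrow> real \<Rightarrow> real" where
  "sine_product c n m \<theta>
     = (cos ((real n - real m) * \<theta>) - Re (cis ((real n + real m) * \<theta>) * phase c \<theta>)) / 2"

lemma continuous_on_sine_product: "continuous_on A (sine_product c n m)"
  unfolding sine_product_def by (intro continuous_intros) auto

text \<open>The function is even, because reflection conjugates the phase term and only its real
  part enters. The integral is therefore half of that over a full period.\<close>

lemma integral_sine_product:
  "integral {0..pi} (sine_product c n m)
     = ((if n = m then 2 * pi else 0) - Re (phase_coeff c (int (n + m)))) / 4"
proof -
  let ?f = "sine_product c n m"
  have "((\<lambda>\<theta>. (Re (cis (of_int (int n - int m) * \<theta>)) - Re (cis (of_int (int (n + m)) * \<theta>) * phase c \<theta>)) / 2)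
      has_integral (Re (if int n - int m = 0 then of_real (2 * pi) else 0) - Re (phase_coeff c (int (n + m)))) / 2)
      {- pi..pi}"
    by (intro has_integral_divide has_integral_diff has_integral_phase_coeff has_integral_cis
        has_integral_Re)
  then have "(?f has_integral ((if n = m then 2 * pi else 0) - Re (phase_coeff c (int (n + m)))) / 2) {- pi..pi}"
    by (cases "n = m") (simp_all add: sine_product_def[abs_def])
  then have full: "integral {- pi..pi} ?f = ((if n = m then 2 * pi else 0) - Re (phase_coeff c (int (n + m)))) / 2"
    by (rule integral_unique)
  have even: "?f (- \<theta>) = ?f \<theta>" for \<theta>
  proof -
    have "cis (- ((real n + real m) * \<theta>)) * cnj (phase c \<theta>) = cnj (cis ((real n + real m) * \<theta>) * phase c \<theta>)"
      by (simp add: cis_cnj)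
    then show ?thesis by (simp only: sine_product_def phase_minus mult_minus_right cos_minus cnj.simps(1))
  qed
  have "integral {- pi..pi} ?f = integral {- pi..0} ?f + integral {0..pi} ?f"
    by (rule Henstock_Kurzweil_Integration.integral_combine[symmetric])
       (auto intro!: integrable_continuous_real continuous_on_sine_product)
  also have "integral {- pi..0} ?f = integral {0..pi} ?f"
    using Henstock_Kurzweil_Integration.integral_reflect_real[of pi 0 ?f] by (simp add: even)
  finally show ?thesis using full by simp
qed

text \<open>The prefactor is the absolute Jacobian of \<open>t = 2 * s * cos \<theta>\<close>.
  Together with the square root it supplies one \<open>sin \<theta>\<close> for each
  polynomial.\<close>

lemma dickson_integrand_cos:
  assumes "s > 0" and sin: "sin \<theta> > 0" and cos: "cos \<theta> \<noteq> 0"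
  shows "2 * s * sin \<theta> * dickson_integrand (s\<^sup>2) k n m (2 * s * cos \<theta>)
    = 4 * s ^ (n + m) * sine_product (k - 1) n m \<theta>"
proof -
  define t where "t = 2 * s * cos \<theta>"
  define c where "c = k - 1"
  define q where "q = 1 + c\<^sup>2 + 2 * c * cos (2 * \<theta>)"
  have t: "t \<noteq> 0" using assms by (simp add: t_def)
  \<comment> \<open>This is the squared modulus of c + cis(2\<theta>); its imaginary part is
    nonzero, which covers \<open>\<bar>c\<bar> = 1\<close> as well.\<close>
  have "q = (c + cos (2 * \<theta>))\<^sup>2 + (sin (2 * \<theta>))\<^sup>2"
    using sin_cos_squared_add[of "2 * \<theta>"] by (simp add: q_def power2_sum)
  moreover have "sin (2 * \<theta>) \<noteq> 0" using sin cos by (simp add: sin_double)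
  ultimately have q: "q \<noteq> 0" by (metis sum_power2_eq_zero_iff)
  have "4 * s\<^sup>2 - t\<^sup>2 = (2 * s * sin \<theta>)\<^sup>2"
    by (simp add: t_def power_mult_distrib cos_squared_eq algebra_simps)
  then have root: "sqrt (4 * s\<^sup>2 - t\<^sup>2) = 2 * s * sin \<theta>" using assms by simp
  have denom: "(k - 1) * t\<^sup>2 + s\<^sup>2 * (k - 2)\<^sup>2 = s\<^sup>2 * q"
    unfolding t_def q_def c_def cos_double_cos by (simp add: power2_eq_square algebra_simps)
  \<comment> \<open>For \<open>t \<noteq> 0\<close> the polynomial quotient is division by
    \<open>t\<close>, so the case \<open>k = 2\<close> obeys the general formula with denominator
    t^2.\<close>
  have div: "poly (dickson a 2 j div [:0, 1:]) t = poly (dickson a 2 j) t / t" for a j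
  proof -
    have "dickson a 2 j = [:0, 1:] * (dickson a 2 j div [:0, 1:])"
      by (rule dvd_mult_div_cancel[OF X_dvd_dickson_2, symmetric])
    then have "poly (dickson a 2 j) t = t * poly (dickson a 2 j div [:0, 1:]) t"
      by (metis poly_mult poly_pCons poly_0 mult_zero_right add_0 add.right_neutral mult.right_neutral)
    with t show ?thesis by simp
  qed
  have "dickson_integrand (s\<^sup>2) k n m t = 2 * s * sin \<theta> * poly (dickson (s\<^sup>2) k n) t * poly (dickson (s\<^sup>2) k m) t / (s\<^sup>2 * q)"
    unfolding dickson_integrand_def denom[symmetric] root div
    by (auto simp: power2_eq_square)
  then have "2 * s * sin \<theta> * dickson_integrand (s\<^sup>2) k n m t
      = 4 * ((sin \<theta> * poly (dickson (s\<^sup>2) k n) t) * (sin \<theta> * poly (dickson (s\<^sup>2) k m) t) / q)"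
    using \<open>s > 0\<close> q by (simp add: field_simps power2_eq_square)
  also have "\<dots> = 4 * s ^ (n + m) * ((sin ((real n + 1) * \<theta>) + c * sin ((real n - 1) * \<theta>))
      * (sin ((real m + 1) * \<theta>) + c * sin ((real m - 1) * \<theta>)) / q)"
    unfolding t_def sin_times_dickson by (simp add: c_def power_add)
  also have "\<dots> = 4 * s ^ (n + m) * sine_product c n m \<theta>"
    unfolding q_def sine_product_def sin_sum_product[OF q[unfolded q_def]] ..
  finally show ?thesis by (simp add: t_def c_def)
qed

lemma integral_dickson_integrand:
  assumes "s > 0"
  shows "integral {- 2 * s..2 * s} (dickson_integrand (s\<^sup>2) k n m)
     = s ^ (n + m) * ((if n = m then 2 * pi else 0) - Re (phase_coeff (k - 1) (int (n + m))))"
proof -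
  let ?g = "\<lambda>\<theta>. 2 * s * cos \<theta>" and ?f = "dickson_integrand (s\<^sup>2) k n m"
    and ?h = "\<lambda>\<theta>. 4 * s ^ (n + m) * sine_product (k - 1) n m \<theta>"
  \<comment> \<open>The zeros of \<open>sin\<close> and \<open>cos\<close> in the interval, where
    \<open>dickson_integrand_cos\<close> does not apply.\<close>
  let ?F = "{0, pi / 2, pi}"
  have negl: "negligible ?F" by (intro negligible_finite) simp
  have eq: "\<bar>- (2 * s * sin \<theta>)\<bar> * ?f (?g \<theta>) = ?h \<theta>" if "\<theta> \<in> {0..pi} - ?F" for \<theta>
  proof -
    have "sin \<theta> > 0" using that by (intro sin_gt_zero) auto
    moreover have "cos \<theta> \<noteq> 0"
      using that cos_inj_pi[of \<theta> "pi / 2"] by auto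
    ultimately show ?thesis
      using dickson_integrand_cos[of s \<theta> k n m] assms by (simp add: abs_mult)
  qed
  \<comment> \<open>The change of variables asks for absolute integrability; it is carried over from
    the continuous \<open>?h\<close> across the null set \<open>?F\<close>.\<close>
  have "?h absolutely_integrable_on {0..pi}"
    by (intro absolutely_integrable_continuous_real continuous_intros continuous_on_sine_product)
  then have "(\<lambda>\<theta>. \<bar>- (2 * s * sin \<theta>)\<bar> * ?f (?g \<theta>)) absolutely_integrable_on {0..pi}"
    using negl eq by (rule absolutely_integrable_spike)
  moreover have "integral {0..pi} (\<lambda>\<theta>. \<bar>- (2 * s * sin \<theta>)\<bar> * ?f (?g \<theta>)) = integral {0..pi} ?h"
    by (rule integral_spike[OF negl]) (rule eq[symmetric])
  moreover have "inj_on ?g {0..pi}"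
    using assms by (auto simp: inj_on_def intro: cos_inj_pi)
  moreover have "(?g has_field_derivative - (2 * s * sin \<theta>)) (at \<theta> within {0..pi})" for \<theta>
    by (auto intro!: derivative_eq_intros)
  ultimately have "integral (?g ` {0..pi}) ?f = integral {0..pi} ?h"
    using has_absolute_integral_change_of_variables_1'[of "{0..pi}" ?g "\<lambda>\<theta>. - (2 * s * sin \<theta>)" ?f]
    by auto
  moreover have "?g ` {0..pi} = {- 2 * s..2 * s}"
  proof (intro equalityI subsetI)
    fix t assume "t \<in> ?g ` {0..pi}"
    then obtain \<theta> where \<theta>: "t = 2 * s * cos \<theta>" by auto
    have "\<bar>t\<bar> \<le> 2 * s * 1"
      unfolding \<theta> abs_mult using assms by (intro mult_mono) auto
    then show "t \<in> {- 2 * s..2 * s}" by auto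
  next
    fix t assume "t \<in> {- 2 * s..2 * s}"
    then have "- 1 \<le> t / (2 * s)" "t / (2 * s) \<le> 1"
      using assms by (auto simp: field_simps)
    then have "t = ?g (arccos (t / (2 * s)))" "arccos (t / (2 * s)) \<in> {0..pi}"
      using assms by (auto simp: cos_arccos arccos_lbound arccos_ubound)
    then show "t \<in> ?g ` {0..pi}" by blast
  qed
  ultimately show ?thesis
    by (simp add: integral_sine_product)
qed

section \<open>The discrete term and the orthogonality relation\<close>

lemma dickson_discrete_term_eq_0: "k \<in> {0..2} \<Longrightarrow> dickson_discrete_term a k n m = 0"
  by (simp add: dickson_discrete_term_def dickson_chi_def)

lemma dickson_discrete_term_odd: "odd (n + m) \<Longrightarrow> dickson_discrete_term a k n m = 0"
  by (simp add: dickson_discrete_term_def)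

text \<open>Only even powers of \<open>csqrt\<close> occur, so squaring removes the branch and the
  term is real.\<close>

lemma dickson_discrete_term_even:
  assumes "k \<notin> {0..2}" "n + m = 2 * p"
  shows "dickson_discrete_term a k n m = of_real ((2 - k) * k / (k - 1) * (- (a / (k - 1))) ^ p)"
proof -
  have "(\<i> * csqrt (of_real (a / (k - 1)))) ^ (2 * p) = (- of_real (a / (k - 1))) ^ p"
    by (simp only: power_mult power_mult_distrib power2_csqrt power2_i mult_minus1)
  moreover have "dickson_chi k = 1" "k \<noteq> 1"
    using assms(1) by (auto simp: dickson_chi_def)
  ultimately show ?thesis
    unfolding dickson_discrete_term_def assms(2) by simp
qed

theorem corollary30:
  fixes a k :: real and n m :: nat
  assumes "a > 0"
  shows "complex_of_real
           (1 / (2 * pi) * integral {- 2 * sqrt a .. 2 * sqrt a} (\<lambda>t. dickson_integrand a k n m t))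
         + dickson_discrete_term a k n m
         = complex_of_real (dickson_h a k n * (if n = m then 1 else 0))"
proof -
  define s c where "s = sqrt a" and "c = k - 1"
  have s: "s > 0" "s\<^sup>2 = a" using assms by (simp_all add: s_def)
  have even_power: "s ^ (2 * p) = a ^ p" for p by (simp add: power_mult s)
  define I where "I = 1 / (2 * pi) * integral {- 2 * s..2 * s} (dickson_integrand a k n m)"
  have I: "I = s ^ (n + m) * ((if n = m then 1 else 0) - Re (phase_coeff c (int (n + m))) / (2 * pi))"
    using integral_dickson_integrand[OF s(1), of k n m]
    by (simp add: I_def s(2) c_def diff_divide_distrib right_diff_distrib)
  have "of_real I + dickson_discrete_term a k n m = of_real (dickson_h a k n * (if n = m then 1 else 0))"
  proof (cases "k \<in> {0..2}")
    case True
    then have "\<bar>c\<bar> \<le> 1" by (auto simp: c_def)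
    have "I = dickson_h a k n * (if n = m then 1 else 0)"
    \<comment> \<open>At \<open>n = m = 0\<close> the coefficient \<open>2 * pi * c\<close> gives 1
      - c = 2 - k; for all other pairs it vanishes, leaving \<open>s ^ (n + m)\<close>, that is
      \<open>a ^ n\<close>, on the diagonal.\<close>
    proof (cases "n + m = 0")
      case True
      then show ?thesis
        unfolding I phase_coeff_inside[OF \<open>\<bar>c\<bar> \<le> 1\<close>] by (simp add: dickson_h_def c_def)
    next
      case False
      then show ?thesis
        unfolding I phase_coeff_inside[OF \<open>\<bar>c\<bar> \<le> 1\<close>] using even_power[of n, unfolded mult_2]
        by (auto simp: dickson_h_def)
    qed
    with True show ?thesis by (simp add: dickson_discrete_term_eq_0)
  next
    case False
    then have c: "\<bar>c\<bar> > 1" by (auto simp: c_def)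
    then have "c \<noteq> 0" by auto
    have k_eq: "k = c + 1" by (simp add: c_def)
    show ?thesis
    proof (cases "odd (n + m)")
      case True
      then obtain p where "n + m = 2 * p + 1" by (elim oddE)
      moreover have "n \<noteq> m" using True by auto
      ultimately have "I = 0" by (simp only: I phase_coeff_outside_odd[OF c]) simp
      with \<open>n \<noteq> m\<close> True show ?thesis by (simp add: dickson_discrete_term_odd)
    next
      case even: False
      then obtain p where p: "n + m = 2 * p" by (metis evenE)
      have "I + (2 - k) * k / (k - 1) * (- (a / (k - 1))) ^ p = dickson_h a k n * (if n = m then 1 else 0)"
      proof (cases "p = 0")
        case True
        with p have "n = 0" "m = 0" by auto
        then have "I = 1 - 1 / c"
          by (simp add: I phase_coeff_outside_0[OF c])
        \<comment> \<open>The discrete term is (1 - c)(1 + c)/c = 1/c - c, so the sum is 1 -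
          c.\<close>
        moreover have "1 - 1 / c + (2 - k) * k / (k - 1) = 2 - k"
          unfolding k_eq using \<open>c \<noteq> 0\<close> by (simp add: field_simps)
        ultimately show ?thesis
          using True \<open>n = 0\<close> \<open>m = 0\<close> by (simp add: dickson_h_def)
      next
        case False
        have "I = a ^ p * ((if n = m then 1 else 0) + (c - 1 / c) * (- 1 / c) ^ p)"
          using False by (simp only: I p phase_coeff_outside_even[OF c] even_power) simp
        \<comment> \<open>The discrete term is exactly the negative of the geometric contribution to
          \<open>I\<close>.\<close>
        moreover have "(2 - k) * k / (k - 1) * (- (a / (k - 1))) ^ p = - (a ^ p * ((c - 1 / c) * (- 1 / c) ^ p))"
        proof -
          have "(2 - k) * k / (k - 1) = - (c - 1 / c)"
            unfolding k_eq using \<open>c \<noteq> 0\<close> by (simp add: field_simps)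
          moreover have "(- (a / (k - 1))) ^ p = a ^ p * (- 1 / c) ^ p"
            by (simp add: c_def power_mult_distrib[symmetric])
          ultimately show ?thesis by (simp only: mult_ac minus_mult_left)
        qed
        \<comment> \<open>On the diagonal \<open>p\<close> is \<open>n\<close>, which identifies
          \<open>a ^ p\<close> with \<open>dickson_h a k n\<close>.\<close>
        moreover have "n = m \<Longrightarrow> n = p \<and> n \<noteq> 0" using p False by simp
        ultimately show ?thesis by (cases "n = m") (simp_all add: dickson_h_def distrib_left)
      qed
      then show ?thesis
        unfolding dickson_discrete_term_even[OF False p] of_real_add[symmetric] by simp
    qed
  qed
  then show ?thesis by (simp add: I_def s_def)
qed
end
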